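(* Let $X$ be a non-constant smooth vector field on $\mathbb{H}^2$ and let $\lambda,\rho\in\mathbb{R}$. If $(\mathbb{H}^2,ds^2,X,\lambda,\rho)$ is a Ricci-Bourguignon soliton, then $X$ is a Killing vector field. Moreover, there exist $a,b,c\in\mathbb{R}$ such that \[ X_{(x,y)}=\left(\frac{a}{2}(x^2-y^2)+bx+c\right)\frac{\partial}{\partial x}+(axy+by)\frac{\partial}{\partial y}. \]
   Context: $\mathbb{H}^2=\{(x,y)\in\mathbb{R}^2 : y>0\}$ with the hyperbolic metric $ds^2=\frac{dx^2+dy^2}{y^2}$. A Riemannian manifold $(M,g)$ with Ricci tensor $\mathrm{Ric}$ and scalar curvature $S$, together with a smooth vector field $X$ and real constants $\lambda,\rho$, is a Ricci-Bourguignon soliton if $\mathrm{Ric}+\frac12\mathcal{L}_Xg=(\lambda+\rho S)g$, where $\mathcal{L}_X$ is the Lie derivative; here this is used in dimension $2$. A vector field is constant if its components in the coordinates $(x,y)$ are constant functions. *)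

theory Defs
  imports "HOL-Analysis.Analysis"
begin

text \<open>
  Riemannian geometry on an open subset of \<open>real ^ 'n\<close>, covered by the single chart given by
  the standard coordinates. A metric is given by its matrix of components, a vector field by its
  vector of components. All conditions are imposed only at points of the domain \<open>U\<close>; since
  \<open>U\<close> is open, values outside it do not affect derivatives at these points.
\<close>

fun C_k_on :: "nat \<Rightarrow> 'a::real_normed_vector set \<Rightarrow> ('a \<Rightarrow> 'b::real_normed_vector) \<Rightarrow> bool" where
  "C_k_on 0 U f \<longleftrightarrow> continuous_on U f"
| "C_k_on (Suc k) U f \<longleftrightarrow>
     (\<forall>p\<in>U. f differentiable (at p)) \<and> (\<forall>v. C_k_on k U (\<lambda>p. frechet_derivative f (at p) v))"

text \<open>Intended for open \<open>U\<close> in a finite-dimensional space, where continuity of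
  all directional derivatives amounts to continuity of the derivative.\<close>

definition smooth_on :: "'a::real_normed_vector set \<Rightarrow> ('a \<Rightarrow> 'b::real_normed_vector) \<Rightarrow> bool" where
  "smooth_on U f \<longleftrightarrow> (\<forall>k. C_k_on k U f)"

definition partial :: "'n::finite \<Rightarrow> (real ^ 'n \<Rightarrow> real) \<Rightarrow> real ^ 'n \<Rightarrow> real" where
  "partial i f p = frechet_derivative f (at p) (axis i 1)"

definition riemannian_metric_on :: "(real ^ 'n) set \<Rightarrow> (real ^ 'n \<Rightarrow> real ^ 'n ^ 'n) \<Rightarrow> bool" where
  "riemannian_metric_on U g \<longleftrightarrow> open U \<and> smooth_on U g \<and>
     (\<forall>p\<in>U. transpose (g p) = g p \<and> (\<forall>v. v \<noteq> 0 \<longrightarrow> v \<bullet> (g p *v v) > 0))"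

text \<open>\<open>christoffel g k i j\<close> is \<open>\<Gamma>\<^sup>k\<^sub>i\<^sub>j\<close>, for the Levi-Civita connection.\<close>

definition christoffel ::
    "(real ^ 'n \<Rightarrow> real ^ 'n ^ 'n) \<Rightarrow> 'n \<Rightarrow> 'n \<Rightarrow> 'n \<Rightarrow> real ^ 'n \<Rightarrow> real" where
  "christoffel g k i j p = (1/2) * (\<Sum>l\<in>UNIV. matrix_inv (g p) $ k $ l *
     (partial i (\<lambda>q. g q $ j $ l) p + partial j (\<lambda>q. g q $ i $ l) p - partial l (\<lambda>q. g q $ i $ j) p))"

text \<open>
  \<open>riemann g l k i j\<close> is the component \<open>R\<^sup>l\<^sub>k\<^sub>i\<^sub>j\<close> of \<open>R(\<partial>\<^sub>i, \<partial>\<^sub>j) \<partial>\<^sub>k = \<Sum>\<^sub>l R\<^sup>l\<^sub>k\<^sub>i\<^sub>j \<partial>\<^sub>l\<close>, where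
  \<open>R(X, Y) Z = \<nabla>\<^sub>X \<nabla>\<^sub>Y Z - \<nabla>\<^sub>Y \<nabla>\<^sub>X Z - \<nabla>\<^bsub>[X,Y]\<^esub> Z\<close>. The Ricci tensor is \<open>Ric(Y, Z) = tr (V \<mapsto> R(V, Y) Z)\<close>,
  so that round spheres have positive Ricci curvature.
\<close>

definition riemann ::
    "(real ^ 'n \<Rightarrow> real ^ 'n ^ 'n) \<Rightarrow> 'n \<Rightarrow> 'n \<Rightarrow> 'n \<Rightarrow> 'n \<Rightarrow> real ^ 'n \<Rightarrow> real" where
  "riemann g l k i j p =
     partial i (christoffel g l j k) p - partial j (christoffel g l i k) p
     + (\<Sum>m\<in>UNIV. christoffel g l i m p * christoffel g m j k p
                - christoffel g l j m p * christoffel g m i k p)"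

definition ricci :: "(real ^ 'n \<Rightarrow> real ^ 'n ^ 'n) \<Rightarrow> real ^ 'n \<Rightarrow> real ^ 'n ^ 'n" where
  "ricci g p = (\<chi> j k. \<Sum>i\<in>UNIV. riemann g i k i j p)"

definition scalar_curvature :: "(real ^ 'n \<Rightarrow> real ^ 'n ^ 'n) \<Rightarrow> real ^ 'n \<Rightarrow> real" where
  "scalar_curvature g p = (\<Sum>i\<in>UNIV. \<Sum>j\<in>UNIV. matrix_inv (g p) $ i $ j * ricci g p $ i $ j)"

text \<open>
  The components of \<open>(L\<^sub>X g)(Y, Z) = X (g(Y, Z)) - g([X, Y], Z) - g(Y, [X, Z])\<close> for the coordinate
  fields \<open>Y = \<partial>\<^sub>i\<close>, \<open>Z = \<partial>\<^sub>j\<close>.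
\<close>

definition lie_derivative_metric ::
    "(real ^ 'n \<Rightarrow> real ^ 'n) \<Rightarrow> (real ^ 'n \<Rightarrow> real ^ 'n ^ 'n) \<Rightarrow> real ^ 'n \<Rightarrow> real ^ 'n ^ 'n" where
  "lie_derivative_metric X g p = (\<chi> i j. \<Sum>k\<in>UNIV.
       X p $ k * partial k (\<lambda>q. g q $ i $ j) p
     + g p $ k $ j * partial i (\<lambda>q. X q $ k) p
     + g p $ i $ k * partial j (\<lambda>q. X q $ k) p)"

definition killing_field_on ::
    "(real ^ 'n) set \<Rightarrow> (real ^ 'n \<Rightarrow> real ^ 'n ^ 'n) \<Rightarrow> (real ^ 'n \<Rightarrow> real ^ 'n) \<Rightarrow> bool" where
  "killing_field_on U g X \<longleftrightarrow> smooth_on U X \<and> (\<forall>p\<in>U. lie_derivative_metric X g p = 0)"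

definition ricci_bourguignon_soliton ::
    "(real ^ 'n) set \<Rightarrow> (real ^ 'n \<Rightarrow> real ^ 'n ^ 'n) \<Rightarrow> (real ^ 'n \<Rightarrow> real ^ 'n) \<Rightarrow> real \<Rightarrow> real \<Rightarrow> bool" where
  "ricci_bourguignon_soliton U g X lam rho \<longleftrightarrow>
     riemannian_metric_on U g \<and> smooth_on U X \<and>
     (\<forall>p\<in>U. ricci g p + (1/2) *\<^sub>R lie_derivative_metric X g p
            = (lam + rho * scalar_curvature g p) *\<^sub>R g p)"

definition hyperbolic_plane :: "(real ^ 2) set" where
  "hyperbolic_plane = {p. p $ 2 > 0}"

definition hyperbolic_metric :: "real ^ 2 \<Rightarrow> real ^ 2 ^ 2" where
  "hyperbolic_metric p = (1 / (p $ 2)\<^sup>2) *\<^sub>R mat 1"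

end

theory Submission
  imports Defs
begin

text \<open>
  The hyperbolic plane has constant curvature: \<open>Ric = - g\<close> and \<open>S = - 2\<close>. The soliton equation
  therefore says \<open>L\<^sub>X g = 2 \<kappa> g\<close> with the constant \<open>\<kappa> = \<lambda> - 2 \<rho> + 1\<close>, so \<open>X\<close> is a homothetic
  field (\<open>soliton_homothetic\<close>).

  For \<open>X = (u, v)\<close> and \<open>g = (dx\<^sup>2 + dy\<^sup>2) / y\<^sup>2\<close> this is the linear system
  \<open>u\<^sub>x = v\<^sub>y = v / y + \<kappa>\<close>, \<open>u\<^sub>y + v\<^sub>x = 0\<close> (\<open>homothetic_equations\<close>). Integrating the first two
  equations along coordinate lines produces \<open>\<kappa> ln y\<close> terms, which the third one rules out unless
  \<open>\<kappa> = 0\<close>. What survives is \<open>v = y (a x + b)\<close> with \<open>u\<close> a primitive, the three-parameter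
  family of the claim (\<open>homothetic_system_solution\<close>), and \<open>\<kappa> = 0\<close> is precisely the Killing
  equation.
\<close>

section \<open>Partial derivatives in the plane\<close>

lemma partial_eqI:
  assumes "(f has_derivative f') (at p)"
  shows "partial i f p = f' (axis i 1)"
  using frechet_derivative_at[OF assms] by (simp add: partial_def)

text \<open>Curvature differentiates Christoffel symbols, whose formula is known only on the half-plane;
  being open, the half-plane determines their derivatives.\<close>

lemma partial_cong_open:
  assumes "open U" "p \<in> U" "\<And>q. q \<in> U \<Longrightarrow> f q = h q" "(h has_derivative h') (at p)"
  shows "partial i f p = partial i h p"
proof -
  have "(f has_derivative h') (at p)"
    using has_derivative_transform_within_open[OF assms(4,1,2)] assms(3) by force
  then show ?thesis
    using assms(4) by (simp add: partial_eqI)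
qed

lemma partial_comp_component:
  fixes p :: "real ^ 'n"
  assumes "(f has_real_derivative d) (at (p $ j))"
  shows "partial i (\<lambda>q. f (q $ j)) p = (if i = j then d else 0)"
proof -
  have "((\<lambda>q::real ^ 'n. q $ j) has_derivative (\<lambda>v. v $ j)) (at p)"
    by (rule bounded_linear_imp_has_derivative) (rule bounded_linear_vec_nth)
  from has_derivative_compose[OF this, of f "\<lambda>h. d * h"] assms
  have "((\<lambda>q. f (q $ j)) has_derivative (\<lambda>v. d * (v $ j))) (at p)"
    by (simp add: has_field_derivative_def)
  from partial_eqI[OF this] show ?thesis
    by (auto simp: axis_def)
qed

lemma has_real_derivative_along_axis:
  fixes f :: "real ^ 'n \<Rightarrow> real"
  assumes "f differentiable (at (\<gamma> t))"
    and "(\<gamma> has_derivative (\<lambda>h. h *\<^sub>R axis i 1)) (at t)"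
  shows "((\<lambda>s. f (\<gamma> s)) has_real_derivative partial i f (\<gamma> t)) (at t)"
proof -
  let ?D = "frechet_derivative f (at (\<gamma> t))"
  have D: "(f has_derivative ?D) (at (\<gamma> t))"
    using assms(1) frechet_derivative_works by blast
  have "((\<lambda>s. f (\<gamma> s)) has_derivative (\<lambda>h. ?D (h *\<^sub>R axis i 1))) (at t)"
    using has_derivative_compose[OF assms(2) D] .
  moreover have "?D (h *\<^sub>R axis i 1) = partial i f (\<gamma> t) * h" for h
    using linear_cmul[OF has_derivative_linear[OF D]] by (simp add: partial_def)
  ultimately show ?thesis
    by (simp add: has_field_derivative_def)
qed

lemma vector_2_eq_axes: "(vector [x, y] :: real ^ 2) = x *\<^sub>R axis 1 1 + y *\<^sub>R axis 2 1"
  by (simp add: vec_eq_iff forall_2 axis_def)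

lemma has_real_derivative_horizontal:
  fixes f :: "real ^ 2 \<Rightarrow> real"
  assumes "f differentiable (at (vector [x, y]))"
  shows "((\<lambda>t. f (vector [t, y])) has_real_derivative partial 1 f (vector [x, y])) (at x)"
  by (rule has_real_derivative_along_axis[of f "\<lambda>t. vector [t, y]"])
     (use assms in \<open>auto simp: vector_2_eq_axes intro!: derivative_eq_intros\<close>)

lemma has_real_derivative_vertical:
  fixes f :: "real ^ 2 \<Rightarrow> real"
  assumes "f differentiable (at (vector [x, y]))"
  shows "((\<lambda>t. f (vector [x, t])) has_real_derivative partial 2 f (vector [x, y])) (at y)"
  by (rule has_real_derivative_along_axis[of f "\<lambda>t. vector [x, t]"])
     (use assms in \<open>auto simp: vector_2_eq_axes intro!: derivative_eq_intros\<close>)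

lemma smooth_on_component_differentiable:
  fixes X :: "'a::real_normed_vector \<Rightarrow> real ^ 'n"
  assumes "smooth_on U X" "p \<in> U"
  shows "(\<lambda>q. X q $ k) differentiable (at p)"
proof -
  have "C_k_on (Suc 0) U X"
    using assms(1) by (simp only: smooth_on_def)
  then obtain D where "(X has_derivative D) (at p)"
    using assms(2) by (auto simp: differentiable_def)
  from bounded_linear.has_derivative[OF bounded_linear_vec_nth this] show ?thesis
    by (auto simp: differentiable_def)
qed

section \<open>Curvature of the hyperbolic plane\<close>

lemma open_hyperbolic_plane: "open hyperbolic_plane"
  unfolding hyperbolic_plane_def by (intro open_Collect_less continuous_intros)

lemma hyperbolic_metric_component:
  "hyperbolic_metric q $ i $ j = (if i = j then 1 / (q $ 2)\<^sup>2 else 0)"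
  by (simp add: hyperbolic_metric_def mat_def)

lemma matrix_inv_eqI:
  fixes A :: "real ^ 'n ^ 'm"
  assumes "A ** B = mat 1" "B ** A = mat 1"
  shows "matrix_inv A = B"
proof -
  define C where "C = matrix_inv A"
  have "A ** C = mat 1 \<and> C ** A = mat 1"
    unfolding C_def matrix_inv_def by (rule someI[of _ B]) (use assms in simp)
  then have "C = B"
    by (metis assms(1) matrix_mul_assoc matrix_mul_lid matrix_mul_rid)
  then show ?thesis
    by (simp add: C_def)
qed

lemma matrix_inv_hyperbolic_metric:
  assumes "p \<in> hyperbolic_plane"
  shows "matrix_inv (hyperbolic_metric p) = (p $ 2)\<^sup>2 *\<^sub>R mat 1"
proof -
  have y: "p $ 2 \<noteq> 0"
    using assms by (simp add: hyperbolic_plane_def)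
  then have "hyperbolic_metric p ** ((p $ 2)\<^sup>2 *\<^sub>R mat 1) = mat 1"
    by (simp add: vec_eq_iff forall_2 matrix_matrix_mult_def hyperbolic_metric_component mat_def sum_2)
  moreover from y have "((p $ 2)\<^sup>2 *\<^sub>R mat 1) ** hyperbolic_metric p = mat 1"
    by (simp add: vec_eq_iff forall_2 matrix_matrix_mult_def hyperbolic_metric_component mat_def sum_2)
  ultimately show ?thesis
    by (rule matrix_inv_eqI)
qed

lemma partial_hyperbolic_metric:
  assumes "p \<in> hyperbolic_plane"
  shows "partial k (\<lambda>q. hyperbolic_metric q $ i $ j) p =
    (if i = j \<and> k = 2 then - 2 / (p $ 2) ^ 3 else 0)"
proof -
  have "((\<lambda>t. if i = j then 1 / t\<^sup>2 else 0) has_real_derivative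
      (if i = j then - 2 / (p $ 2) ^ 3 else 0)) (at (p $ 2))"
    using assms
    by (auto simp: hyperbolic_plane_def divide_simps power2_eq_square power3_eq_cube
        intro!: derivative_eq_intros)
  from partial_comp_component[OF this] show ?thesis
    by (simp add: hyperbolic_metric_component)
qed

text \<open>
  In the half-plane model every Christoffel symbol is a constant multiple of \<open>1 / y\<close>. This
  constant is isolated so that the symbols can be differentiated all at once.
\<close>

definition hyperbolic_christoffel_coeff :: "2 \<Rightarrow> 2 \<Rightarrow> 2 \<Rightarrow> real" where
  "hyperbolic_christoffel_coeff k i j =
    (if k = 1 then (if i = j then 0 else - 1)
     else (if i \<noteq> j then 0 else if i = 1 then 1 else - 1))"

lemma christoffel_hyperbolic:
  assumes "p \<in> hyperbolic_plane"
  shows "christoffel hyperbolic_metric k i j p = hyperbolic_christoffel_coeff k i j * (1 / p $ 2)"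
  using assms exhaust_2[of k] exhaust_2[of i] exhaust_2[of j]
  unfolding christoffel_def matrix_inv_hyperbolic_metric[OF assms]
    partial_hyperbolic_metric[OF assms] hyperbolic_christoffel_coeff_def
  by (auto simp: hyperbolic_plane_def sum_2 mat_def power2_eq_square power3_eq_cube)

lemma partial_christoffel_hyperbolic:
  assumes "p \<in> hyperbolic_plane"
  shows "partial l (christoffel hyperbolic_metric k i j) p =
    (if l = 2 then - hyperbolic_christoffel_coeff k i j / (p $ 2)\<^sup>2 else 0)"
proof -
  let ?c = "hyperbolic_christoffel_coeff k i j"
  have y: "p $ 2 > 0"
    using assms by (simp add: hyperbolic_plane_def)
  have "((\<lambda>q. ?c * (1 / q $ 2)) has_derivative (\<lambda>v. - ?c * v $ 2 / (p $ 2)\<^sup>2)) (at p)"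
    using y by (auto simp: power2_eq_square field_simps intro!: derivative_eq_intros
        bounded_linear_imp_has_derivative[OF bounded_linear_vec_nth])
  from partial_cong_open[OF open_hyperbolic_plane assms christoffel_hyperbolic this]
    partial_eqI[OF this]
  have "partial l (christoffel hyperbolic_metric k i j) p = - ?c * axis l 1 $ 2 / (p $ 2)\<^sup>2"
    by simp
  then show ?thesis
    by (simp add: axis_def)
qed

lemma ricci_hyperbolic:
  assumes "p \<in> hyperbolic_plane"
  shows "ricci hyperbolic_metric p = - hyperbolic_metric p"
proof -
  have "p $ 2 > 0"
    using assms by (simp add: hyperbolic_plane_def)
  then show ?thesis
    unfolding ricci_def riemann_def partial_christoffel_hyperbolic[OF assms]
      christoffel_hyperbolic[OF assms]
    by (simp add: vec_eq_iff forall_2 sum_2 hyperbolic_metric_component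
        hyperbolic_christoffel_coeff_def power2_eq_square)
qed

lemma scalar_curvature_hyperbolic:
  assumes "p \<in> hyperbolic_plane"
  shows "scalar_curvature hyperbolic_metric p = - 2"
  using assms unfolding scalar_curvature_def ricci_hyperbolic[OF assms]
    matrix_inv_hyperbolic_metric[OF assms]
  by (simp add: hyperbolic_plane_def sum_2 mat_def hyperbolic_metric_component)

section \<open>Homothetic fields of the hyperbolic plane\<close>

lemma lie_derivative_hyperbolic:
  fixes X :: "real ^ 2 \<Rightarrow> real ^ 2"
  assumes "p \<in> hyperbolic_plane"
  shows "lie_derivative_metric X hyperbolic_metric p $ i $ j =
    (partial i (\<lambda>q. X q $ j) p + partial j (\<lambda>q. X q $ i) p
      - (if i = j then 2 * X p $ 2 / p $ 2 else 0)) / (p $ 2)\<^sup>2"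
  using assms exhaust_2[of i] exhaust_2[of j]
  unfolding lie_derivative_metric_def partial_hyperbolic_metric[OF assms]
  by (auto simp: hyperbolic_plane_def sum_2 hyperbolic_metric_component field_simps
      power2_eq_square power3_eq_cube)

lemma homothetic_equations:
  fixes X :: "real ^ 2 \<Rightarrow> real ^ 2"
  assumes p: "p \<in> hyperbolic_plane"
    and L: "lie_derivative_metric X hyperbolic_metric p = (2 * \<kappa>) *\<^sub>R hyperbolic_metric p"
  shows "partial 1 (\<lambda>q. X q $ 1) p = X p $ 2 / p $ 2 + \<kappa>"
    and "partial 2 (\<lambda>q. X q $ 2) p = X p $ 2 / p $ 2 + \<kappa>"
    and "partial 1 (\<lambda>q. X q $ 2) p = - partial 2 (\<lambda>q. X q $ 1) p"
proof -
  have y: "(p $ 2)\<^sup>2 > 0"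
    using p by (simp add: hyperbolic_plane_def)
  have E: "partial i (\<lambda>q. X q $ j) p + partial j (\<lambda>q. X q $ i) p
      - (if i = j then 2 * X p $ 2 / p $ 2 else 0) = (if i = j then 2 * \<kappa> else 0)" for i j
    using arg_cong[OF L, of "\<lambda>A. A $ i $ j"] y
    unfolding lie_derivative_hyperbolic[OF p]
    by (cases "i = j") (auto simp: hyperbolic_metric_component)
  show "partial 1 (\<lambda>q. X q $ 1) p = X p $ 2 / p $ 2 + \<kappa>"
    using E[of 1 1] by simp
  show "partial 2 (\<lambda>q. X q $ 2) p = X p $ 2 / p $ 2 + \<kappa>"
    using E[of 2 2] by simp
  show "partial 1 (\<lambda>q. X q $ 2) p = - partial 2 (\<lambda>q. X q $ 1) p"
    using E[of 1 2] by simp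
qed

lemma eq_if_DERIV_eq_on_convex:
  fixes f g :: "real \<Rightarrow> real"
  assumes "convex S"
    and "\<And>x. x \<in> S \<Longrightarrow> (f has_real_derivative d x) (at x)"
    and "\<And>x. x \<in> S \<Longrightarrow> (g has_real_derivative d x) (at x)"
    and "x \<in> S" "z \<in> S"
  shows "f x - g x = f z - g z"
proof -
  have "((\<lambda>x. f x - g x) has_real_derivative 0) (at x within S)" if "x \<in> S" for x
    using DERIV_diff[OF assms(2,3)[OF that]] by (auto intro: has_field_derivative_at_within)
  then obtain c where "\<And>x. x \<in> S \<Longrightarrow> f x - g x = c"
    using has_field_derivative_zero_constant[OF assms(1), of "\<lambda>x. f x - g x"] by blast
  then show ?thesis
    using assms(4,5) by simp
qed

text \<open>
  The diagonal equations determine \<open>v\<close> from \<open>f x = v x 1\<close>, namely \<open>v x y = y * (f x + \<kappa> * ln y)\<close>, and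
  determine \<open>u\<close> from its values on the lines \<open>y = 1\<close> and \<open>x = 0\<close>, namely
  \<open>u x y = u x 1 + \<kappa> * x * ln y + u 0 y - u 0 1\<close>. With these, the off-diagonal equation
  \<open>u\<^sub>y = - v\<^sub>x\<close> reads \<open>y * (f' x - f' 0) = - \<kappa> * x / y\<close>. The two sides scale differently in \<open>y\<close>, so
  both vanish: \<open>\<kappa> = 0\<close>, and \<open>f\<close> is affine. Expressing \<open>u\<close> by its values on two lines replaces the
  usual comparison of mixed second derivatives, so that first derivatives suffice.
\<close>

lemma homothetic_system_solution:
  fixes u v w :: "real \<Rightarrow> real \<Rightarrow> real"
  assumes ux: "\<And>x y. y > 0 \<Longrightarrow> ((\<lambda>t. u t y) has_real_derivative v x y / y + \<kappa>) (at x)"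
    and vy: "\<And>x y. y > 0 \<Longrightarrow> ((\<lambda>t. v x t) has_real_derivative v x y / y + \<kappa>) (at y)"
    and uy: "\<And>x y. y > 0 \<Longrightarrow> ((\<lambda>t. u x t) has_real_derivative w x y) (at y)"
    and vx: "\<And>x y. y > 0 \<Longrightarrow> ((\<lambda>t. v t y) has_real_derivative - w x y) (at x)"
  shows "\<kappa> = 0 \<and> (\<exists>a b c. \<forall>x y. y > 0 \<longrightarrow>
    u x y = a / 2 * (x\<^sup>2 - y\<^sup>2) + b * x + c \<and> v x y = a * x * y + b * y)"
proof -
  have v: "v x y = y * (v x 1 + \<kappa> * ln y)" if "y > 0" for x y
  proof -
    have "v x y / y - \<kappa> * ln y = v x 1 / 1 - \<kappa> * ln 1"
    proof (rule eq_if_DERIV_eq_on_convex[of "{0<..}" "\<lambda>t. v x t / t" "\<lambda>t. \<kappa> / t"])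
      show "((\<lambda>t. v x t / t) has_real_derivative \<kappa> / t) (at t)" if "t \<in> {0<..}" for t
        using that by (auto intro!: derivative_eq_intros vy simp: field_simps)
      show "((\<lambda>t. \<kappa> * ln t) has_real_derivative \<kappa> / t) (at t)" if "t \<in> {0<..}" for t
        using that by (auto intro!: derivative_eq_intros)
    qed (use that in auto)
    then show ?thesis
      using that by (simp add: field_simps)
  qed
  have w: "w x y = y * w x 1" if "y > 0" for x y
  proof -
    have "((\<lambda>t. y * (v t 1 + \<kappa> * ln y)) has_real_derivative y * (- w x 1)) (at x)"
      by (auto intro!: derivative_eq_intros vx)
    then have "((\<lambda>t. v t y) has_real_derivative y * (- w x 1)) (at x)"
      by (simp add: v[OF that])
    from DERIV_unique[OF vx[OF that] this] show ?thesis
      by simp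
  qed
  have u: "u x y = u x 1 + \<kappa> * x * ln y + u 0 y - u 0 1" if "y > 0" for x y
  proof -
    have "u x y - (u x 1 + \<kappa> * ln y * x) = u 0 y - (u 0 1 + \<kappa> * ln y * 0)"
    proof (rule eq_if_DERIV_eq_on_convex[of UNIV "\<lambda>t. u t y" "\<lambda>t. v t y / y + \<kappa>"])
      show "((\<lambda>t. u t 1 + \<kappa> * ln y * t) has_real_derivative v t y / y + \<kappa>) (at t)" for t
        using that v[OF that] by (auto intro!: derivative_eq_intros ux)
    qed (use that ux in auto)
    then show ?thesis
      by (simp add: algebra_simps)
  qed
  have wx: "y * w x 1 = \<kappa> * x / y + y * w 0 1" if "y > 0" for x y
  proof -
    have "((\<lambda>t. u x 1 + \<kappa> * x * ln t + u 0 t - u 0 1) has_real_derivative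
        \<kappa> * x / y + w 0 y) (at y)"
      using that by (auto intro!: derivative_eq_intros uy)
    then have "((\<lambda>t. u x t) has_real_derivative \<kappa> * x / y + w 0 y) (at y)"
    proof (rule has_field_derivative_transform_within_open)
      show "u x 1 + \<kappa> * x * ln t + u 0 t - u 0 1 = u x t" if "t \<in> {0<..}" for t
        using u[of t x] that by simp
    qed (use that in auto)
    from DERIV_unique[OF uy[OF that] this] show ?thesis
      using w[OF that] by simp
  qed
  \<comment> \<open>At \<open>x = 1\<close>, the heights \<open>1\<close> and \<open>2\<close> separate the scalings \<open>y\<close> and \<open>1 / y\<close>.\<close>
  have \<kappa>: "\<kappa> = 0"
    using wx[of 1 1] wx[of 2 1] by simp
  define a b where "a = - w 0 1" and "b = v 0 1"
  have f: "v x 1 = a * x + b" for x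
  proof -
    have "v x 1 - a * x = v 0 1 - a * 0"
    proof (rule eq_if_DERIV_eq_on_convex[of UNIV "\<lambda>t. v t 1" "\<lambda>_. a"])
      show "((\<lambda>t. v t 1) has_real_derivative a) (at t)" for t
        using vx[of 1 t] wx[of 1 t] \<kappa> by (simp add: a_def)
    qed (auto intro!: derivative_eq_intros)
    then show ?thesis
      by (simp add: b_def)
  qed
  have u1: "u x 1 = a / 2 * x\<^sup>2 + b * x + u 0 1" for x
  proof -
    have "u x 1 - (a / 2 * x\<^sup>2 + b * x) = u 0 1 - (a / 2 * 0\<^sup>2 + b * 0)"
    proof (rule eq_if_DERIV_eq_on_convex[of UNIV "\<lambda>t. u t 1" "\<lambda>t. a * t + b"])
      show "((\<lambda>t. u t 1) has_real_derivative a * t + b) (at t)" for t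
        using ux[of 1 t] f \<kappa> by simp
    qed (auto intro!: derivative_eq_intros)
    then show ?thesis
      by simp
  qed
  have u0: "u 0 y = u 0 1 + a / 2 - a / 2 * y\<^sup>2" if "y > 0" for y
  proof -
    have "u 0 y - (- a / 2 * y\<^sup>2) = u 0 1 - (- a / 2 * 1\<^sup>2)"
    proof (rule eq_if_DERIV_eq_on_convex[of "{0<..}" "\<lambda>t. u 0 t" "\<lambda>t. - a * t"])
      show "((\<lambda>t. u 0 t) has_real_derivative - a * t) (at t)" if "t \<in> {0<..}" for t
        using uy[of t 0] w[of t 0] that by (simp add: a_def mult.commute)
    qed (use that in \<open>auto intro!: derivative_eq_intros\<close>)
    then show ?thesis
      by simp
  qed
  have "u x y = a / 2 * (x\<^sup>2 - y\<^sup>2) + b * x + (u 0 1 + a / 2) \<and> v x y = a * x * y + b * y"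
    if "y > 0" for x y
    using u[OF that, of x] u1[of x] u0[OF that] v[OF that, of x] f[of x] \<kappa>
    by (simp add: algebra_simps)
  with \<kappa> show ?thesis
    by blast
qed

text \<open>The curvature terms are constant multiples of the metric, which turns the soliton equation
  into the equation of a homothetic field.\<close>

lemma soliton_homothetic:
  assumes "ricci_bourguignon_soliton hyperbolic_plane hyperbolic_metric X lam rho"
    and p: "p \<in> hyperbolic_plane"
  shows "lie_derivative_metric X hyperbolic_metric p
    = (2 * (lam - 2 * rho + 1)) *\<^sub>R hyperbolic_metric p"
proof -
  let ?g = "hyperbolic_metric p"
  have "- ?g + (1/2) *\<^sub>R lie_derivative_metric X hyperbolic_metric p = (lam - 2 * rho) *\<^sub>R ?g"
    using assms unfolding ricci_bourguignon_soliton_def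
    by (auto simp: ricci_hyperbolic scalar_curvature_hyperbolic)
  then have "(1/2) *\<^sub>R lie_derivative_metric X hyperbolic_metric p = (lam - 2 * rho + 1) *\<^sub>R ?g"
    by (simp add: algebra_simps)
  from arg_cong[OF this, of "(*\<^sub>R) 2"] show ?thesis
    by simp
qed

theorem corollary3p3:
  fixes X :: "real ^ 2 \<Rightarrow> real ^ 2" and lam rho :: real
  assumes "smooth_on hyperbolic_plane X"
    and "\<not> X constant_on hyperbolic_plane"
    and "ricci_bourguignon_soliton hyperbolic_plane hyperbolic_metric X lam rho"
  shows "killing_field_on hyperbolic_plane hyperbolic_metric X \<and>
    (\<exists>a b c :: real. \<forall>x y :: real. y > 0 \<longrightarrow>
       X (vector [x, y]) = vector [a / 2 * (x\<^sup>2 - y\<^sup>2) + b * x + c, a * x * y + b * y])"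
proof -
  define \<kappa> where "\<kappa> = lam - 2 * rho + 1"
  have L: "lie_derivative_metric X hyperbolic_metric p = (2 * \<kappa>) *\<^sub>R hyperbolic_metric p"
    if "p \<in> hyperbolic_plane" for p
    using soliton_homothetic[OF assms(3) that] by (simp add: \<kappa>_def)
  have H: "vector [x, y] \<in> hyperbolic_plane" if "y > 0" for x y :: real
    using that by (simp add: hyperbolic_plane_def)
  have D: "(\<lambda>q. X q $ k) differentiable (at (vector [x, y]))" if "y > 0" for x y k
    using smooth_on_component_differentiable[OF assms(1) H[OF that]] .
  define u v w where "u x y = X (vector [x, y]) $ 1" and "v x y = X (vector [x, y]) $ 2"
    and "w x y = partial 2 (\<lambda>q. X q $ 1) (vector [x, y])" for x y
  have "((\<lambda>t. u t y) has_real_derivative v x y / y + \<kappa>) (at x)"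
    "((\<lambda>t. v x t) has_real_derivative v x y / y + \<kappa>) (at y)"
    "((\<lambda>t. u x t) has_real_derivative w x y) (at y)"
    "((\<lambda>t. v t y) has_real_derivative - w x y) (at x)" if "y > 0" for x y
    using has_real_derivative_horizontal[OF D[OF that, where k = 1 and x = x]]
      has_real_derivative_vertical[OF D[OF that, where k = 2 and x = x]]
      has_real_derivative_vertical[OF D[OF that, where k = 1 and x = x]]
      has_real_derivative_horizontal[OF D[OF that, where k = 2 and x = x]]
      homothetic_equations[OF H[OF that, where x = x] L[OF H[OF that, where x = x]]]
    by (simp_all add: u_def v_def w_def)
  from homothetic_system_solution[of u v \<kappa> w, OF this] obtain a b c where "\<kappa> = 0"
    and uv: "\<And>x y. y > 0 \<Longrightarrow> u x y = a / 2 * (x\<^sup>2 - y\<^sup>2) + b * x + c \<and> v x y = a * x * y + b * y"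
    by blast
  have "killing_field_on hyperbolic_plane hyperbolic_metric X"
    using assms(1) L \<open>\<kappa> = 0\<close> by (simp add: killing_field_on_def)
  moreover have "X (vector [x, y]) = vector [a / 2 * (x\<^sup>2 - y\<^sup>2) + b * x + c, a * x * y + b * y]"
    if "y > 0" for x y
    using uv[OF that, of x] by (simp add: vec_eq_iff forall_2 u_def v_def)
  ultimately show ?thesis
    by blast
qed

end
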